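(* (Family $(-,-,3)$, Painlevé II.) Let $\theta_\infty\in\mathbb{C}$, and let $p,q$ be holomorphic functions of $t$ on a connected open set $U\subset\mathbb{C}$. Put $$A_0=\begin{pmatrix}p-q^2&2q^3-2pq+tq+\theta_\infty\\-q&q^2-p\end{pmatrix},\quad A_1=\begin{pmatrix}0&2q^2-2p+t\\1&0\end{pmatrix},\quad A_2=\begin{pmatrix}1&0\\0&-1\end{pmatrix},$$ $$B=\begin{pmatrix}\frac q2&q^2-p+\frac t2\\\frac12&-\frac q2\end{pmatrix}+z\begin{pmatrix}\frac12&0\\0&-\frac12\end{pmatrix}.$$ Then the operators $\frac{d}{dz}+A_0+zA_1+z^2A_2$ and $\frac{d}{dt}+B$ commute if and only if $$\frac{dq}{dt}=p,\qquad\frac{dp}{dt}=2q^3+tq+\frac{\theta_\infty+1}2 .$$ This system is the Hamiltonian system $\frac{dq}{dt}=-\frac{\partial H}{\partial p}$, $\frac{dp}{dt}=\frac{\partial H}{\partial q}$ with $$H=\frac12\big(-p^2+q^4+tq^2+(\theta_\infty+1)q\big),$$ and, with $p=q'$, it is equivalent to $q''=2q^3+qt+\frac{\theta_\infty+1}2$.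
   Context: Operators act on vector-valued functions of $(z,t)$; $\frac{d}{dz},\frac{d}{dt}$ are the partial derivatives. Two operators $\frac{d}{dz}+A$ and $\frac{d}{dt}+B$ with matrix functions $A(z,t),B(z,t)$ commute iff $\frac{\partial A}{\partial t}=\frac{\partial B}{\partial z}+AB-BA$ identically in $z,t$. In the Hamiltonian equations $H=H(p,q,t)$ with partial derivatives in the independent variables $p,q,t$; $'$ denotes $\frac{d}{dt}$. (This commutation is the isomonodromy condition for the family of connections.) *)

theory Defs
  imports "HOL-Analysis.Analysis" "HOL-Complex_Analysis.Complex_Analysis"
begin

text \<open>Vector-valued functions of two complex variables $(z,t)$ are written in curried form.
  Holomorphy in two variables on $\mathbb{C} \times U$ is joint continuity together with
  holomorphy in each variable separately (Osgood).\<close>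

definition holomorphic2_on :: "complex set \<Rightarrow> (complex \<Rightarrow> complex \<Rightarrow> complex ^ 'n) \<Rightarrow> bool" where
  "holomorphic2_on U Y \<longleftrightarrow>
     (\<forall>i. continuous_on (UNIV \<times> U) (\<lambda>(z, t). Y z t $ i) \<and>
          (\<forall>t\<in>U. (\<lambda>z. Y z t $ i) holomorphic_on UNIV) \<and>
          (\<forall>z. (\<lambda>t. Y z t $ i) holomorphic_on U))"

definition op_z :: "(complex \<Rightarrow> complex \<Rightarrow> complex ^ 'n ^ 'n)
    \<Rightarrow> (complex \<Rightarrow> complex \<Rightarrow> complex ^ 'n) \<Rightarrow> complex \<Rightarrow> complex \<Rightarrow> complex ^ 'n" where
  "op_z A Y = (\<lambda>z t. (\<chi> i. deriv (\<lambda>w. Y w t $ i) z) + A z t *v Y z t)"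

definition op_t :: "(complex \<Rightarrow> complex \<Rightarrow> complex ^ 'n ^ 'n)
    \<Rightarrow> (complex \<Rightarrow> complex \<Rightarrow> complex ^ 'n) \<Rightarrow> complex \<Rightarrow> complex \<Rightarrow> complex ^ 'n" where
  "op_t B Y = (\<lambda>z t. (\<chi> i. deriv (\<lambda>s. Y z s $ i) t) + B z t *v Y z t)"

text \<open>Commutation as operators on the holomorphic functions on $\mathbb{C} \times U$; the
  zero-curvature equation is not built in.\<close>

definition operators_commute :: "complex set \<Rightarrow> (complex \<Rightarrow> complex \<Rightarrow> complex ^ 'n ^ 'n)
    \<Rightarrow> (complex \<Rightarrow> complex \<Rightarrow> complex ^ 'n ^ 'n) \<Rightarrow> bool" where
  "operators_commute U A B \<longleftrightarrow>
     (\<forall>Y. holomorphic2_on U Y \<longrightarrow>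
        (\<forall>z. \<forall>t\<in>U. op_z A (op_t B Y) z t = op_t B (op_z A Y) z t))"

definition mat2 :: "complex \<Rightarrow> complex \<Rightarrow> complex \<Rightarrow> complex \<Rightarrow> complex ^ 2 ^ 2" where
  "mat2 a b c d = vector [vector [a, b], vector [c, d]]"

definition cscale :: "complex \<Rightarrow> complex ^ 'n ^ 'm \<Rightarrow> complex ^ 'n ^ 'm" where
  "cscale c M = (\<chi> i j. c * M $ i $ j)"

definition A0 :: "complex \<Rightarrow> (complex \<Rightarrow> complex) \<Rightarrow> (complex \<Rightarrow> complex) \<Rightarrow> complex \<Rightarrow> complex ^ 2 ^ 2" where
  "A0 \<theta> p q t =
     mat2 (p t - q t ^ 2) (2 * q t ^ 3 - 2 * p t * q t + t * q t + \<theta>)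
          (- q t)         (q t ^ 2 - p t)"

definition A1 :: "(complex \<Rightarrow> complex) \<Rightarrow> (complex \<Rightarrow> complex) \<Rightarrow> complex \<Rightarrow> complex ^ 2 ^ 2" where
  "A1 p q t = mat2 0 (2 * q t ^ 2 - 2 * p t + t) 1 0"

definition A2 :: "complex ^ 2 ^ 2" where
  "A2 = mat2 1 0 0 (- 1)"

definition A_conn :: "complex \<Rightarrow> (complex \<Rightarrow> complex) \<Rightarrow> (complex \<Rightarrow> complex)
    \<Rightarrow> complex \<Rightarrow> complex \<Rightarrow> complex ^ 2 ^ 2" where
  "A_conn \<theta> p q z t = A0 \<theta> p q t + cscale z (A1 p q t) + cscale (z ^ 2) A2"

definition B_conn :: "(complex \<Rightarrow> complex) \<Rightarrow> (complex \<Rightarrow> complex)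
    \<Rightarrow> complex \<Rightarrow> complex \<Rightarrow> complex ^ 2 ^ 2" where
  "B_conn p q z t =
     mat2 (q t / 2) (q t ^ 2 - p t + t / 2)
          (1 / 2)   (- (q t / 2))
     + cscale z (mat2 (1 / 2) 0 0 (- (1 / 2)))"

definition PII_system :: "complex \<Rightarrow> complex set \<Rightarrow> (complex \<Rightarrow> complex) \<Rightarrow> (complex \<Rightarrow> complex) \<Rightarrow> bool" where
  "PII_system \<theta> U p q \<longleftrightarrow>
     (\<forall>t\<in>U. deriv q t = p t \<and> deriv p t = 2 * q t ^ 3 + t * q t + (\<theta> + 1) / 2)"

definition PII_equation :: "complex \<Rightarrow> complex set \<Rightarrow> (complex \<Rightarrow> complex) \<Rightarrow> bool" where
  "PII_equation \<theta> U q \<longleftrightarrow>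
     (\<forall>t\<in>U. deriv (deriv q) t = 2 * q t ^ 3 + q t * t + (\<theta> + 1) / 2)"

text \<open>Hamiltonians take independent arguments in the order $p, q, t$.\<close>

definition partial_p :: "(complex \<Rightarrow> complex \<Rightarrow> complex \<Rightarrow> complex) \<Rightarrow> complex \<Rightarrow> complex \<Rightarrow> complex \<Rightarrow> complex" where
  "partial_p H x y t = deriv (\<lambda>x'. H x' y t) x"

definition partial_q :: "(complex \<Rightarrow> complex \<Rightarrow> complex \<Rightarrow> complex) \<Rightarrow> complex \<Rightarrow> complex \<Rightarrow> complex \<Rightarrow> complex" where
  "partial_q H x y t = deriv (\<lambda>y'. H x y' t) y"

text \<open>Note the sign convention: $q' = -\partial H/\partial p$ and $p' = \partial H/\partial q$.\<close>

definition hamiltonian_system :: "(complex \<Rightarrow> complex \<Rightarrow> complex \<Rightarrow> complex) \<Rightarrow> complex set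
    \<Rightarrow> (complex \<Rightarrow> complex) \<Rightarrow> (complex \<Rightarrow> complex) \<Rightarrow> bool" where
  "hamiltonian_system H U p q \<longleftrightarrow>
     (\<forall>t\<in>U. deriv q t = - partial_p H (p t) (q t) t \<and> deriv p t = partial_q H (p t) (q t) t)"

definition H_PII :: "complex \<Rightarrow> complex \<Rightarrow> complex \<Rightarrow> complex \<Rightarrow> complex" where
  "H_PII \<theta> x y t = 1 / 2 * (- (x ^ 2) + y ^ 4 + t * y ^ 2 + (\<theta> + 1) * y)"

end

theory Submission
  imports Defs
begin

text \<open>Applying both compositions to a holomorphic $Y$, the mixed second derivatives and the
  first-order terms cancel, so the commutator is multiplication by the matrix
  $\partial_z B - \partial_t A + AB - BA$; constant $Y$ show that it must vanish. For the
  given $A$ and $B$, the entries in the first column of this equation already are the system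
  (the second one is $q' = p$, and the first one is then the equation for $p'$), and the
  remaining entries follow from it.\<close>

section \<open>Symmetry of mixed partial derivatives for functions of two complex variables\<close>

text \<open>Cauchy's inequality on discs of radius \<open>r / 2\<close> bounds the second derivative
  by 8M/r^2 on \<open>ball t (r / 2)\<close>, and this controls the first-order Taylor remainder.
  The bound sees \<open>f\<close> only through \<open>M\<close>, so it is uniform over any family
  with a common bound.\<close>

lemma difference_quotient_bound:
  fixes f :: "complex \<Rightarrow> complex"
  assumes hol: "f holomorphic_on S" and "open S" and sub: "cball t r \<subseteq> S" and "0 < r"
    and M: "\<And>s. s \<in> cball t r \<Longrightarrow> cmod (f s) \<le> M"
    and h: "h \<noteq> 0" "cmod h < r / 2"
  shows "cmod ((f (t + h) - f t) / h - deriv f t) \<le> 8 * M / r\<^sup>2 * cmod h"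
proof -
  let ?B = "fact 2 * M / (r / 2) ^ 2"
  have half: "cball x (r / 2) \<subseteq> cball t r" if "x \<in> ball t (r / 2)" for x
  proof
    fix y assume "y \<in> cball x (r / 2)"
    then show "y \<in> cball t r"
      using that dist_triangle[of t y x] by (simp add: field_simps)
  qed
  have sub': "ball t (r / 2) \<subseteq> S"
    using sub \<open>0 < r\<close> by (auto simp: subset_iff)
  have bound: "cmod ((deriv ^^ Suc 1) f x) \<le> ?B" if "x \<in> ball t (r / 2)" for x
  proof -
    have "cmod ((deriv ^^ 2) f x) \<le> ?B"
    proof (rule Cauchy_inequality)
      show "f holomorphic_on ball x (r / 2)"
        using hol half[OF that] sub ball_subset_cball by (meson holomorphic_on_subset order_trans)
      show "continuous_on (cball x (r / 2)) f"
        using hol half[OF that] sub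
        by (meson holomorphic_on_subset holomorphic_on_imp_continuous_on order_trans)
      show "cmod (f y) \<le> M" if "cmod (x - y) = r / 2" for y
        using that half[OF \<open>x \<in> ball t (r / 2)\<close>] by (intro M) (auto simp: dist_norm)
    qed (use \<open>0 < r\<close> in simp)
    then show ?thesis
      by (simp add: numeral_2_eq_2)
  qed
  \<comment> \<open>\<open>complex_Taylor\<close> divides the remainder of order n + 1 by n! rather
    than (n + 1)!, hence the constant 8 and not 4.\<close>
  have "cmod ((deriv ^^ 0) f (t + h) - (\<Sum>i\<le>1. (deriv ^^ i) f t * (t + h - t) ^ i / fact i))
      \<le> ?B * cmod (t + h - t) ^ Suc 1 / fact 1"
  proof (rule complex_Taylor[where S = "ball t (r / 2)"])
    show "((deriv ^^ i) f has_field_derivative (deriv ^^ Suc i) f x) (at x within ball t (r / 2))"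
      if "x \<in> ball t (r / 2)" for i x
      using has_field_derivative_higher_deriv[OF hol \<open>open S\<close>, of x i] that sub'
      by (meson has_field_derivative_at_within subsetD)
  qed (use bound h \<open>0 < r\<close> in \<open>auto simp: dist_norm\<close>)
  then have "cmod (f (t + h) - f t - deriv f t * h) \<le> 8 * M / r\<^sup>2 * (cmod h)\<^sup>2"
    by (simp add: field_simps power2_eq_square)
  moreover have "(f (t + h) - f t) / h - deriv f t = (f (t + h) - f t - deriv f t * h) / h"
    using h by (simp add: field_simps)
  ultimately show ?thesis
    using h by (simp add: norm_divide field_simps power2_eq_square)
qed

text \<open>A single \<open>D\<close> delivers both the existence of the two mixed derivatives and
  their equality; joint continuity enters through a local bound on \<open>F\<close>.\<close>

lemma mixed_partials:
  fixes F :: "complex \<Rightarrow> complex \<Rightarrow> complex"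
  assumes "open U" and "t \<in> U"
    and cont: "continuous_on (UNIV \<times> U) (\<lambda>(z, t). F z t)"
    and hol_z: "\<And>t. t \<in> U \<Longrightarrow> (\<lambda>z. F z t) holomorphic_on UNIV"
    and hol_t: "\<And>z. F z holomorphic_on U"
  obtains D where "((\<lambda>w. deriv (F w) t) has_field_derivative D) (at z)"
    and "((\<lambda>s. deriv (\<lambda>w. F w s) z) has_field_derivative D) (at t)"
proof -
  obtain r where r: "0 < r" "cball t r \<subseteq> U"
    using \<open>open U\<close> \<open>t \<in> U\<close> open_contains_cball by blast
  \<comment> \<open>One bound \<open>M\<close> for all \<open>w\<close> near \<open>z\<close> makes
    the difference quotients in \<open>t\<close> converge at a rate independent of
    \<open>w\<close>.\<close>
  have "compact ((\<lambda>(z, t). F z t) ` (cball z 1 \<times> cball t r))"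
    using r by (intro compact_continuous_image continuous_on_subset[OF cont] compact_Times) auto
  then obtain M where M: "0 < M"
    "\<And>w s. w \<in> cball z 1 \<Longrightarrow> s \<in> cball t r \<Longrightarrow> cmod (F w s) \<le> M"
    by (auto dest!: compact_imp_bounded simp: bounded_pos)
  (* The difference quotients in t converge uniformly on a disc in z, so their z-derivatives
     converge to the z-derivative of the limit. *)
  define Q where "Q = (\<lambda>h w. (F w (t + h) - F w t) / h)"
  define Q' where "Q' = (\<lambda>h w. (deriv (\<lambda>w. F w (t + h)) w - deriv (\<lambda>w. F w t) w) / h)"
  have near: "\<forall>\<^sub>F h in at 0. h \<noteq> 0 \<and> cmod h < d" if "0 < d" for d
    using that by (auto simp: eventually_at dist_norm)
  have "uniform_limit (cball z 1) Q (\<lambda>w. deriv (F w) t) (at 0)"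
  proof (rule uniform_limitI)
    fix e :: real assume "0 < e"
    \<comment> \<open>The first term allows \<open>difference_quotient_bound\<close> to be applied;
      the second makes its right-hand side smaller than \<open>e\<close>.\<close>
    define d where "d = min (r / 2) (e * r\<^sup>2 / (8 * M))"
    have "0 < d"
      using r M \<open>0 < e\<close> by (simp add: d_def)
    from near[OF this] show "\<forall>\<^sub>F h in at 0. \<forall>w\<in>cball z 1. dist (Q h w) (deriv (F w) t) < e"
    proof eventually_elim
      fix h assume h: "h \<noteq> 0 \<and> cmod h < d"
      show "\<forall>w\<in>cball z 1. dist (Q h w) (deriv (F w) t) < e"
      proof
        fix w assume w: "w \<in> cball z 1"
        have "dist (Q h w) (deriv (F w) t) \<le> 8 * M / r\<^sup>2 * cmod h"
          unfolding Q_def dist_norm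
          using h by (intro difference_quotient_bound[OF hol_t \<open>open U\<close> r(2,1) M(2)[OF w]])
            (auto simp: d_def)
        also have "\<dots> < 8 * M / r\<^sup>2 * (e * r\<^sup>2 / (8 * M))"
          using h r M by (intro mult_strict_left_mono) (auto simp: d_def)
        also have "\<dots> = e"
          using r M by simp
        finally show "dist (Q h w) (deriv (F w) t) < e" .
      qed
    qed
  qed
  moreover have "\<forall>\<^sub>F h in at 0. continuous_on (cball z 1) (Q h)
      \<and> (\<forall>w\<in>ball z 1. (Q h has_field_derivative Q' h w) (at w))"
    using near[OF r(1)]
  proof eventually_elim
    fix h assume h: "h \<noteq> 0 \<and> cmod h < r"
    then have "t + h \<in> U"
      using r by (auto simp: subset_iff dist_norm)
    then have D: "(Q h has_field_derivative Q' h w) (at w)" for w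
      unfolding Q_def Q'_def using \<open>t \<in> U\<close> h
      by (intro DERIV_cdivide DERIV_diff holomorphic_derivI[OF hol_z]) auto
    then show "continuous_on (cball z 1) (Q h)
      \<and> (\<forall>w\<in>ball z 1. (Q h has_field_derivative Q' h w) (at w))"
      by (meson DERIV_isCont continuous_at_imp_continuous_on)
  qed
  ultimately obtain g' where "\<And>w. w \<in> ball z 1 \<Longrightarrow>
      ((\<lambda>w. deriv (F w) t) has_field_derivative g' w) (at w) \<and> ((\<lambda>h. Q' h w) \<longlongrightarrow> g' w) (at 0)"
    using has_complex_derivative_uniform_limit[of z 1 Q Q' "at 0" "\<lambda>w. deriv (F w) t"] by auto
  \<comment> \<open>At \<open>w = z\<close>, \<open>Q' h z\<close> is itself the difference quotient
    in \<open>t\<close> of the z-derivative, so its limit \<open>g' z\<close> is also the other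
    mixed derivative.\<close>
  from this[of z] show thesis
    by (intro that[of "g' z"]) (simp_all add: Q'_def DERIV_def)
qed

section \<open>From commuting operators to the zero-curvature equation\<close>

lemma commutator_eq_curvature:
  fixes A B DA DB :: "complex \<Rightarrow> complex \<Rightarrow> complex ^ 'n ^ 'n"
  assumes "open U" and "t \<in> U"
    and dA: "\<And>i j. ((\<lambda>s. A z s $ i $ j) has_field_derivative DA z t $ i $ j) (at t)"
    and dB: "\<And>i j. ((\<lambda>w. B w t $ i $ j) has_field_derivative DB z t $ i $ j) (at z)"
    and Y: "holomorphic2_on U Y"
  shows "op_z A (op_t B Y) z t - op_t B (op_z A Y) z t
    = (DB z t - DA z t + A z t ** B z t - B z t ** A z t) *v Y z t"
proof -
  have cont: "continuous_on (UNIV \<times> U) (\<lambda>(z, t). Y z t $ i)"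
    and hol_z: "s \<in> U \<Longrightarrow> (\<lambda>z. Y z s $ i) holomorphic_on UNIV"
    and hol_t: "(\<lambda>t. Y w t $ i) holomorphic_on U" for i s w
    using Y by (auto simp: holomorphic2_on_def)
  define Yz where "Yz = (\<chi> i. deriv (\<lambda>w. Y w t $ i) z)"
  define Yt where "Yt = (\<chi> i. deriv (\<lambda>s. Y z s $ i) t)"
  have dYz: "((\<lambda>w. Y w t $ i) has_field_derivative Yz $ i) (at z)" for i
    using holomorphic_derivI[OF hol_z[OF \<open>t \<in> U\<close>]] by (simp add: Yz_def)
  have dYt: "((\<lambda>s. Y z s $ i) has_field_derivative Yt $ i) (at t)" for i
    using holomorphic_derivI[OF hol_t \<open>open U\<close> \<open>t \<in> U\<close>] by (simp add: Yt_def)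
  \<comment> \<open>The outer operators apply \<open>deriv\<close> to components that contain first
    derivatives of \<open>Y\<close>; the product rule below requires these to be
    differentiable.\<close>
  have "\<exists>D. ((\<lambda>w. deriv (\<lambda>s. Y w s $ i) t) has_field_derivative D) (at z)
      \<and> ((\<lambda>s. deriv (\<lambda>w. Y w s $ i) z) has_field_derivative D) (at t)" for i
    using mixed_partials[OF \<open>open U\<close> \<open>t \<in> U\<close> cont hol_z hol_t] by metis
  then obtain D where
    Dz: "((\<lambda>w. deriv (\<lambda>s. Y w s $ i) t) has_field_derivative D i) (at z)" and
    Dt: "((\<lambda>s. deriv (\<lambda>w. Y w s $ i) z) has_field_derivative D i) (at t)" for i
    by metis
  have "((\<lambda>w. op_t B Y w t $ i) has_field_derivative
      ((\<chi> i. D i) + DB z t *v Y z t + B z t *v Yz) $ i) (at z)" for i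
    unfolding op_t_def matrix_vector_mult_def
    by (auto intro!: derivative_eq_intros Dz dB dYz simp: sum.distrib algebra_simps)
  then have 1: "op_z A (op_t B Y) z t =
      ((\<chi> i. D i) + DB z t *v Y z t + B z t *v Yz) + A z t *v (Yt + B z t *v Y z t)"
    unfolding op_z_def[of A "op_t B Y"] by (simp add: DERIV_imp_deriv vec_eq_iff op_t_def Yt_def)
  have "((\<lambda>s. op_z A Y z s $ i) has_field_derivative
      ((\<chi> i. D i) + DA z t *v Y z t + A z t *v Yt) $ i) (at t)" for i
    unfolding op_z_def matrix_vector_mult_def
    by (auto intro!: derivative_eq_intros Dt dA dYt simp: sum.distrib algebra_simps)
  then have 2: "op_t B (op_z A Y) z t =
      ((\<chi> i. D i) + DA z t *v Y z t + A z t *v Yt) + B z t *v (Yz + A z t *v Y z t)"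
    unfolding op_t_def[of B "op_z A Y"] by (simp add: DERIV_imp_deriv vec_eq_iff op_z_def Yz_def)
  show ?thesis
    unfolding 1 2
    by (simp add: matrix_vector_right_distrib matrix_vector_mul_assoc
        matrix_vector_mult_add_rdistrib matrix_vector_mult_diff_rdistrib)
qed

text \<open>Taking \<open>DA\<close> and \<open>DB\<close> as parameters lets closed forms of the
  derivatives be supplied, which turns commutation into a matrix identity.\<close>

lemma operators_commute_iff_zero_curvature:
  fixes A B DA DB :: "complex \<Rightarrow> complex \<Rightarrow> complex ^ 'n ^ 'n"
  assumes "open U"
    and "\<And>z t i j. t \<in> U \<Longrightarrow>
      ((\<lambda>s. A z s $ i $ j) has_field_derivative DA z t $ i $ j) (at t)"
    and "\<And>z t i j. t \<in> U \<Longrightarrow>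
      ((\<lambda>w. B w t $ i $ j) has_field_derivative DB z t $ i $ j) (at z)"
  shows "operators_commute U A B \<longleftrightarrow>
    (\<forall>z. \<forall>t\<in>U. DA z t = DB z t + A z t ** B z t - B z t ** A z t)"
proof -
  define C where "C = (\<lambda>z t. DB z t - DA z t + A z t ** B z t - B z t ** A z t)"
  have curv: "op_z A (op_t B Y) z t = op_t B (op_z A Y) z t \<longleftrightarrow> C z t *v Y z t = 0"
    if "t \<in> U" "holomorphic2_on U Y" for Y z t
    using commutator_eq_curvature[of U t A z DA B DB Y] assms that
    unfolding C_def by (metis right_minus_eq)
  \<comment> \<open>Constant functions take every vector as a value at a given point, so
    \<open>C z t\<close> annihilates all vectors.\<close>
  have const: "holomorphic2_on U (\<lambda>_ _. v)" for v :: "complex ^ 'n"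
    by (simp add: holomorphic2_on_def case_prod_unfold)
  have "operators_commute U A B \<longleftrightarrow> (\<forall>z. \<forall>t\<in>U. C z t = 0)"
  proof
    assume L: "operators_commute U A B"
    have "C z t *v v = 0" if "t \<in> U" for z t v
      using L curv[OF that const[of v]] const[of v] that
      unfolding operators_commute_def by blast
    then show "\<forall>z. \<forall>t\<in>U. C z t = 0"
      by (simp add: matrix_eq)
  next
    assume "\<forall>z. \<forall>t\<in>U. C z t = 0"
    then show "operators_commute U A B"
      unfolding operators_commute_def using curv by simp
  qed
  then show ?thesis
    by (simp add: C_def algebra_simps) (metis add.commute)
qed

section \<open>The zero-curvature equation of the Painleve II connection\<close>

lemma mat2_nth [simp]:
  "mat2 a b c d $ 1 $ 1 = a" "mat2 a b c d $ 1 $ 2 = b"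
  "mat2 a b c d $ 2 $ 1 = c" "mat2 a b c d $ 2 $ 2 = d"
  by (simp_all add: mat2_def)

lemma mat2_eq_iff:
  "mat2 a b c d = mat2 a' b' c' d' \<longleftrightarrow> a = a' \<and> b = b' \<and> c = c' \<and> d = d'"
  by (auto simp: vec_eq_iff forall_2)

lemma mat2_arith:
  "mat2 a b c d + mat2 a' b' c' d' = mat2 (a + a') (b + b') (c + c') (d + d')"
  "mat2 a b c d - mat2 a' b' c' d' = mat2 (a - a') (b - b') (c - c') (d - d')"
  "cscale k (mat2 a b c d) = mat2 (k * a) (k * b) (k * c) (k * d)"
  "mat2 a b c d ** mat2 a' b' c' d' =
     mat2 (a * a' + b * c') (a * b' + b * d') (c * a' + d * c') (c * b' + d * d')"
  by (simp_all add: vec_eq_iff forall_2 cscale_def matrix_matrix_mult_def sum_2)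

text \<open>This is the equation at one fixed \<open>t\<close>, with \<open>P'\<close> and
  \<open>Q'\<close> as free numbers in place of the derivatives. Both connection matrices are
  traceless: \<open>a\<close>, \<open>b\<close>, \<open>c\<close> are the entries of the first,
  \<open>e\<close>, \<open>f\<close> and 1/2 those of the second.\<close>

lemma PII_zero_curvature:
  fixes P Q P' Q' \<theta> t :: complex
  defines "a \<equiv> \<lambda>z. P - Q ^ 2 + z ^ 2"
    and "b \<equiv> \<lambda>z. 2 * Q ^ 3 - 2 * P * Q + t * Q + \<theta> + z * (2 * Q ^ 2 - 2 * P + t)"
    and "c \<equiv> \<lambda>z. z - Q"
    and "e \<equiv> \<lambda>z. (Q + z) / 2" and "f \<equiv> Q ^ 2 - P + t / 2"
  shows "(\<forall>z. mat2 (P' - 2 * Q * Q')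
        (6 * Q ^ 2 * Q' - 2 * (P' * Q + P * Q') + Q + t * Q' + z * (4 * Q * Q' - 2 * P' + 1))
        (- Q') (2 * Q * Q' - P')
      = mat2 (1 / 2) 0 0 (- (1 / 2)) + mat2 (a z) (b z) (c z) (- a z) ** mat2 (e z) f (1 / 2) (- e z)
        - mat2 (e z) f (1 / 2) (- e z) ** mat2 (a z) (b z) (c z) (- a z))
    \<longleftrightarrow> Q' = P \<and> P' = 2 * Q ^ 3 + t * Q + (\<theta> + 1) / 2" (is "(\<forall>z. ?M z) \<longleftrightarrow> ?S")
proof
  assume "\<forall>z. ?M z"
  \<comment> \<open>The first column at z = 0 already determines \<open>Q'\<close> and
    \<open>P'\<close>.\<close>
  then have "?M 0" by blast
  then have 21: "- Q' = c 0 * e 0 - a 0 / 2 - (a 0 / 2 - e 0 * c 0)"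
    and 11: "P' - 2 * Q * Q' = 1 / 2 + (a 0 * e 0 + b 0 / 2) - (e 0 * a 0 + f * c 0)"
    by (simp_all add: mat2_arith mat2_eq_iff)
  from 21 have "Q' = P"
    by (simp add: a_def c_def e_def power2_eq_square)
  \<comment> \<open>The products of \<open>a\<close> and \<open>e\<close> cancel. The summand 1/2
    comes from the z-derivative of the second matrix and shifts \<theta> to \<theta> + 1.\<close>
  with 11 have "P' = 2 * Q * P + (1 / 2 + b 0 / 2 - f * c 0)"
    by (simp add: diff_eq_eq algebra_simps)
  also have "\<dots> = 2 * Q ^ 3 + t * Q + (\<theta> + 1) / 2"
    by (simp add: b_def c_def f_def field_simps power2_eq_square power3_eq_cube)
  finally show ?S
    using \<open>Q' = P\<close> by simp
next
  assume S: ?S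
  show "\<forall>z. ?M z"
    by (simp add: S mat2_arith mat2_eq_iff a_def b_def c_def e_def f_def
        field_simps power2_eq_square power3_eq_cube)
qed

lemma operators_commute_iff_PII_system:
  assumes "open U" and "p holomorphic_on U" and "q holomorphic_on U"
  shows "operators_commute U (A_conn \<theta> p q) (B_conn p q) \<longleftrightarrow> PII_system \<theta> U p q"
proof -
  define DA where "DA = (\<lambda>z t. mat2 (deriv p t - 2 * q t * deriv q t)
    (6 * q t ^ 2 * deriv q t - 2 * (deriv p t * q t + p t * deriv q t) + q t + t * deriv q t
      + z * (4 * q t * deriv q t - 2 * deriv p t + 1))
    (- deriv q t) (2 * q t * deriv q t - deriv p t))"
  define DB where "DB = (\<lambda>(z :: complex) (t :: complex). mat2 (1 / 2) 0 0 (- (1 / 2)))"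
  \<comment> \<open>Collecting the powers of \<open>z\<close> brings the connection into the
    traceless shape of \<open>PII_zero_curvature\<close>.\<close>
  have A: "A_conn \<theta> p q z t = mat2 (p t - q t ^ 2 + z ^ 2)
      (2 * q t ^ 3 - 2 * p t * q t + t * q t + \<theta> + z * (2 * q t ^ 2 - 2 * p t + t))
      (z - q t) (- (p t - q t ^ 2 + z ^ 2))" for z t
    by (simp add: A_conn_def A0_def A1_def A2_def mat2_arith mat2_eq_iff)
  have B: "B_conn p q z t = mat2 ((q t + z) / 2) (q t ^ 2 - p t + t / 2) (1 / 2)
      (- ((q t + z) / 2))" for z t
    by (simp add: B_conn_def mat2_arith mat2_eq_iff field_simps)
  have "operators_commute U (A_conn \<theta> p q) (B_conn p q) \<longleftrightarrow>
    (\<forall>z. \<forall>t\<in>U. DA z t = DB z t + A_conn \<theta> p q z t ** B_conn p q z t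
      - B_conn p q z t ** A_conn \<theta> p q z t)"
  proof (rule operators_commute_iff_zero_curvature[OF \<open>open U\<close>])
    fix z t and i j :: 2
    assume "t \<in> U"
    then have d: "(p has_field_derivative deriv p t) (at t)" "(q has_field_derivative deriv q t) (at t)"
      using assms holomorphic_derivI by blast+
    have "\<forall>i j. ((\<lambda>s. A_conn \<theta> p q z s $ i $ j) has_field_derivative DA z t $ i $ j) (at t)"
      unfolding A DA_def forall_2 mat2_nth
      by (auto intro!: derivative_eq_intros d simp: algebra_simps power2_eq_square)
    then show "((\<lambda>s. A_conn \<theta> p q z s $ i $ j) has_field_derivative DA z t $ i $ j) (at t)"
      by blast
    have "\<forall>i j. ((\<lambda>w. B_conn p q w t $ i $ j) has_field_derivative DB z t $ i $ j) (at z)"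
      unfolding B DB_def forall_2 mat2_nth by (auto intro!: derivative_eq_intros)
    then show "((\<lambda>w. B_conn p q w t $ i $ j) has_field_derivative DB z t $ i $ j) (at z)"
      by blast
  qed
  also have "\<dots> \<longleftrightarrow> PII_system \<theta> U p q"
    unfolding A B DA_def DB_def PII_system_def PII_zero_curvature[symmetric] by blast
  finally show ?thesis .
qed

section \<open>Hamiltonian form and the second-order equation\<close>

lemma partials_H_PII:
  "- partial_p (H_PII \<theta>) x y t = x"
  "partial_q (H_PII \<theta>) x y t = 2 * y ^ 3 + t * y + (\<theta> + 1) / 2"
proof -
  have "((\<lambda>x'. H_PII \<theta> x' y t) has_field_derivative - x) (at x)"
    unfolding H_PII_def by (auto intro!: derivative_eq_intros)
  then show "- partial_p (H_PII \<theta>) x y t = x"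
    by (simp add: partial_p_def DERIV_imp_deriv)
  have "((\<lambda>y'. H_PII \<theta> x y' t) has_field_derivative 2 * y ^ 3 + t * y + (\<theta> + 1) / 2) (at y)"
    unfolding H_PII_def by (auto intro!: derivative_eq_intros simp: field_simps)
  then show "partial_q (H_PII \<theta>) x y t = 2 * y ^ 3 + t * y + (\<theta> + 1) / 2"
    by (simp add: partial_q_def DERIV_imp_deriv)
qed

lemma PII_system_iff_PII_equation:
  assumes "open U"
  shows "PII_system \<theta> U p q \<longleftrightarrow> (\<forall>t\<in>U. p t = deriv q t) \<and> PII_equation \<theta> U q"
proof -
  \<comment> \<open>Equality at \<open>t\<close> alone would not suffice: \<open>p\<close> and
    \<open>deriv q\<close> agree on a neighbourhood of \<open>t\<close> because \<open>U\<close> is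
    open.\<close>
  have "deriv p t = deriv (deriv q) t" if "\<forall>t\<in>U. p t = deriv q t" "t \<in> U" for t
    using that eventually_nhds_in_open[OF \<open>open U\<close> \<open>t \<in> U\<close>]
    by (intro deriv_cong_ev) (auto elim: eventually_mono)
  then show ?thesis
    unfolding PII_system_def PII_equation_def by (auto simp: mult.commute)
qed

theorem mainTheorem18:
  fixes \<theta> :: complex and U :: "complex set" and p q :: "complex \<Rightarrow> complex"
  assumes "open U" and "connected U"
    and "p holomorphic_on U" and "q holomorphic_on U"
  shows "(operators_commute U (A_conn \<theta> p q) (B_conn p q) \<longleftrightarrow> PII_system \<theta> U p q)
    \<and> (\<forall>x y t. - partial_p (H_PII \<theta>) x y t = x
          \<and> partial_q (H_PII \<theta>) x y t = 2 * y ^ 3 + t * y + (\<theta> + 1) / 2)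
    \<and> (PII_system \<theta> U p q \<longleftrightarrow> hamiltonian_system (H_PII \<theta>) U p q)
    \<and> (PII_system \<theta> U p q \<longleftrightarrow> (\<forall>t\<in>U. p t = deriv q t) \<and> PII_equation \<theta> U q)"
  using operators_commute_iff_PII_system[OF assms(1,3,4)] PII_system_iff_PII_equation[OF assms(1)]
  by (simp add: partials_H_PII PII_system_def hamiltonian_system_def)

end
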